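(* Fix an evidence law $Q$ and let $\Theta(Q)=\{\theta\in\Theta: Q_{\theta,n}=Q\}$ be the set of worlds compatible with $Q$. There exists one action $a\in\mathcal{A}$, depending only on $Q$, that has zero oracle regret for every world compatible with $Q$ (that is, $R_\theta(a)=\min_{b\in\mathcal{A}}R_\theta(b)$ for all $\theta\in\Theta(Q)$) if and only if $$\bigcap_{\theta\in\Theta(Q)}\mathcal{A}^*(\theta)\neq\varnothing .$$ If every world in $\Theta(Q)$ has a unique oracle action, this condition means that all worlds in $\Theta(Q)$ have the same oracle action.
   Context: $\mathcal{A}$ is a finite nonempty set of actions and $\Theta$ is a family of worlds. Each world $\theta\in\Theta$ assigns to every action $a\in\mathcal{A}$ a real risk $R_\theta(a)$, and the oracle action set is $\mathcal{A}^*(\theta)=\arg\min_{a\in\mathcal{A}}R_\theta(a)$. In world $\theta$ an observation (the evidence) $Z_n$ is generated, with values in a fixed measurable space; its probability law is denoted $Q_{\theta,n}$. An evidence law is a probability measure on that space. The oracle regret of an action $a$ in world $\theta$ is $R_\theta(a)-\min_{b\in\mathcal{A}}R_\theta(b)$. Intersections over $\Theta(Q)$ are taken inside $\mathcal{A}$. *)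

theory Defs
  imports "HOL-Probability.Probability"
begin

definition oracle_actions :: "'a set \<Rightarrow> ('w \<Rightarrow> 'a \<Rightarrow> real) \<Rightarrow> 'w \<Rightarrow> 'a set" where
  "oracle_actions A R \<theta> = {a. is_arg_min (R \<theta>) (\<lambda>b. b \<in> A) a}"

(* Meaningful only in worlds whose oracle action is unique. *)
definition oracle_action :: "'a set \<Rightarrow> ('w \<Rightarrow> 'a \<Rightarrow> real) \<Rightarrow> 'w \<Rightarrow> 'a" where
  "oracle_action A R \<theta> = (THE a. a \<in> oracle_actions A R \<theta>)"

definition oracle_regret :: "'a set \<Rightarrow> ('w \<Rightarrow> 'a \<Rightarrow> real) \<Rightarrow> 'w \<Rightarrow> 'a \<Rightarrow> real" where
  "oracle_regret A R \<theta> a = R \<theta> a - Min (R \<theta> ` A)"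

(* World \<theta> has its own probability space P \<theta>, on which the observation Z \<theta> n with values
   in the fixed measurable space M (only its sigma-algebra matters) is defined. *)
definition observation_law ::
  "('w \<Rightarrow> 'o measure) \<Rightarrow> 'z measure \<Rightarrow> ('w \<Rightarrow> nat \<Rightarrow> 'o \<Rightarrow> 'z) \<Rightarrow> 'w \<Rightarrow> nat \<Rightarrow> 'z measure" where
  "observation_law P M Z \<theta> n = distr (P \<theta>) M (Z \<theta> n)"

definition compatible_worlds :: "'w set \<Rightarrow> ('w \<Rightarrow> nat \<Rightarrow> 'z measure) \<Rightarrow> nat \<Rightarrow> 'z measure \<Rightarrow> 'w set" where
  "compatible_worlds \<Theta> law n Q = {\<theta> \<in> \<Theta>. law \<theta> n = Q}"

(* The intersection is taken inside A, so it is A when no world is compatible with the evidence. *)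
definition common_oracle_actions :: "'a set \<Rightarrow> ('w \<Rightarrow> 'a \<Rightarrow> real) \<Rightarrow> 'w set \<Rightarrow> 'a set" where
  "common_oracle_actions A R W = A \<inter> (\<Inter>\<theta>\<in>W. oracle_actions A R \<theta>)"

end

theory Submission
  imports Defs
begin

text \<open>On a finite \<open>A\<close> the minimal risk is attained, so an action of
  \<open>A\<close> has zero regret in a world exactly when it is an oracle action there
  (\<open>oracle_regret_eq_0_iff\<close>). One action serves all worlds of a set \<open>W\<close>
  iff it lies in every oracle set, that is, in their intersection within \<open>A\<close>. The
  evidence enters only through the choice of \<open>W\<close>, so the lemmas treat arbitrary
  \<open>W\<close>; as the action is chosen before the world, it is the same for all of
  \<open>W\<close>. If all oracle sets over \<open>W\<close> are singletons, their intersection is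
  inhabited iff the singletons coincide
  (\<open>common_oracle_action_iff_same_oracle_action\<close>).\<close>

lemma oracle_regret_eq_0_iff:
  assumes "finite A" and "a \<in> A"
  shows "oracle_regret A R \<theta> a = 0 \<longleftrightarrow> a \<in> oracle_actions A R \<theta>"
proof -
  have "oracle_regret A R \<theta> a = 0 \<longleftrightarrow> Min (R \<theta> ` A) = R \<theta> a"
    by (auto simp: oracle_regret_def)
  \<comment> \<open>Since \<open>a \<in> A\<close>, its risk belongs to the image, so being the
    minimum reduces to being a lower bound.\<close>
  also have "\<dots> \<longleftrightarrow> (\<forall>b\<in>A. R \<theta> a \<le> R \<theta> b)"
    using assms by (subst Min_eq_iff) auto
  also have "\<dots> \<longleftrightarrow> a \<in> oracle_actions A R \<theta>"
    using assms by (auto simp: oracle_actions_def is_arg_min_linorder)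
  finally show ?thesis .
qed

lemma zero_regret_action_iff_common_oracle_action:
  assumes "finite A"
  shows "(\<exists>a\<in>A. \<forall>\<theta>\<in>W. oracle_regret A R \<theta> a = 0) \<longleftrightarrow> common_oracle_actions A R W \<noteq> {}"
proof -
  have "(\<forall>\<theta>\<in>W. oracle_regret A R \<theta> a = 0) \<longleftrightarrow> (\<forall>\<theta>\<in>W. a \<in> oracle_actions A R \<theta>)"
    if "a \<in> A" for a
    by (simp add: oracle_regret_eq_0_iff[OF assms that])
  then show ?thesis
    unfolding common_oracle_actions_def by blast
qed

text \<open>Uniqueness is what makes the \<open>THE\<close> in \<open>oracle_action\<close> denote
  an actual oracle action.\<close>

lemma oracle_actions_eq_singleton:
  assumes "\<exists>!a. a \<in> oracle_actions A R \<theta>"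
  shows "oracle_actions A R \<theta> = {oracle_action A R \<theta>}"
  using theI'[OF assms] assms unfolding oracle_action_def by blast

lemma common_oracle_action_iff_same_oracle_action:
  assumes "A \<noteq> {}" and unique: "\<forall>\<theta>\<in>W. \<exists>!a. a \<in> oracle_actions A R \<theta>"
  shows "common_oracle_actions A R W \<noteq> {} \<longleftrightarrow>
    (\<forall>\<theta>\<in>W. \<forall>\<theta>'\<in>W. oracle_action A R \<theta> = oracle_action A R \<theta>')"
proof (cases "W = {}")
  case True
  \<comment> \<open>With no worlds the intersection is \<open>A\<close> itself, which is nonempty,
    and the agreement of oracle actions is vacuous.\<close>
  with \<open>A \<noteq> {}\<close> show ?thesis by (simp add: common_oracle_actions_def)
next
  case False
  then obtain \<theta>0 where \<theta>0: "\<theta>0 \<in> W" by blast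
  have singleton: "oracle_actions A R \<theta> = {oracle_action A R \<theta>}" if "\<theta> \<in> W" for \<theta>
    using bspec[OF unique that] by (rule oracle_actions_eq_singleton)
  have subset: "oracle_actions A R \<theta> \<subseteq> A" for \<theta>
    by (auto simp: oracle_actions_def is_arg_min_def)
  have "a \<in> common_oracle_actions A R W \<longleftrightarrow> (\<forall>\<theta>\<in>W. a = oracle_action A R \<theta>)" for a
  proof -
    have "a \<in> common_oracle_actions A R W \<longleftrightarrow> (\<forall>\<theta>\<in>W. a \<in> oracle_actions A R \<theta>)"
      using subset[of \<theta>0] \<theta>0 by (auto simp: common_oracle_actions_def)
    also have "\<dots> \<longleftrightarrow> (\<forall>\<theta>\<in>W. a = oracle_action A R \<theta>)"
      by (simp add: singleton)
    finally show ?thesis .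
  qed
  then have "common_oracle_actions A R W \<noteq> {} \<longleftrightarrow> (\<exists>a. \<forall>\<theta>\<in>W. a = oracle_action A R \<theta>)"
    by (simp add: ex_in_conv[symmetric])
  \<comment> \<open>If all oracle actions agree, that of \<open>\<theta>0\<close> is the witness for
    \<open>a\<close>.\<close>
  also have "\<dots> \<longleftrightarrow> (\<forall>\<theta>\<in>W. \<forall>\<theta>'\<in>W. oracle_action A R \<theta> = oracle_action A R \<theta>')"
    using \<theta>0 by metis
  finally show ?thesis .
qed

theorem theorem2:
  fixes A :: "'a set"
    and \<Theta> :: "'w set"
    and R :: "'w \<Rightarrow> 'a \<Rightarrow> real"
    and P :: "'w \<Rightarrow> 'o measure"
    and M :: "'z measure"
    and Z :: "'w \<Rightarrow> nat \<Rightarrow> 'o \<Rightarrow> 'z"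
    and n :: nat
    and Q :: "'z measure"
  assumes "finite A" and "A \<noteq> {}"
    and "\<And>\<theta>. \<theta> \<in> \<Theta> \<Longrightarrow> prob_space (P \<theta>)"
    and "\<And>\<theta>. \<theta> \<in> \<Theta> \<Longrightarrow> Z \<theta> n \<in> measurable (P \<theta>) M"
    and "Q \<in> space (prob_algebra M)"
  shows "let W = compatible_worlds \<Theta> (observation_law P M Z) n Q in
    ((\<exists>a\<in>A. \<forall>\<theta>\<in>W. oracle_regret A R \<theta> a = 0) \<longleftrightarrow> common_oracle_actions A R W \<noteq> {}) \<and>
    ((\<forall>\<theta>\<in>W. \<exists>!a. a \<in> oracle_actions A R \<theta>) \<longrightarrow>
      (common_oracle_actions A R W \<noteq> {} \<longleftrightarrow>
        (\<forall>\<theta>\<in>W. \<forall>\<theta>'\<in>W. oracle_action A R \<theta> = oracle_action A R \<theta>')))"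
  unfolding Let_def
  by (rule conjI[OF zero_regret_action_iff_common_oracle_action[OF assms(1)]
        impI[OF common_oracle_action_iff_same_oracle_action[OF assms(2)]]])

end
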